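(* Let $p,q,r,s\in(1,\infty)$ be real numbers such that $\frac1p+\frac1q+\frac1r+\frac1s=3$, and let $\gamma(y)=e^{-\frac12 y^2}$ (which belongs to $L_r(\mathbb{R})$). For any functions $f\in L_p(\mathbb{R})$, $g\in L_q(\mathbb{R})$ and $h\in L_s(\mathbb{R})$, $$\left|\int_{\mathbb{R}}\big(f\underset{T_c}{\overset{\gamma}{*}}g\big)(x)\,h(x)\,dx\right|\leq \frac{1}{2\pi}\left(\sqrt{\frac{2\pi}{r}}\right)^{1/r}\|f\|_{L_p(\mathbb{R})}\|g\|_{L_q(\mathbb{R})}\|h\|_{L_s(\mathbb{R})}.$$
   Context: For functions $f,g$ on $\mathbb{R}$, the iterated Fourier-cosine convolution with Gaussian weight $\gamma(y)=e^{-\frac12y^2}$ is $$\big(f\underset{T_c}{\overset{\gamma}{*}}g\big)(x):=\frac{1}{8\pi}\int_{\mathbb{R}^2}f(u)g(v)G(x,u,v)\,du\,dv,\quad x\in\mathbb{R},$$ where $$G(x,u,v)=e^{-\frac12(x+u+v)^2}+e^{-\frac12(x+u-v)^2}+e^{-\frac12(x-u+v)^2}+e^{-\frac12(x-u-v)^2}.$$ *)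

theory Defs
  imports "HOL-Analysis.Analysis"
begin

text \<open>Elements are functions rather than almost-everywhere classes;
  measurability is with respect to the Lebesgue sigma-algebra.\<close>

definition Lp_space :: "real \<Rightarrow> (real \<Rightarrow> 'a::real_normed_vector) set" where
  "Lp_space p = {f \<in> borel_measurable lebesgue. integrable lebesgue (\<lambda>x. norm (f x) powr p)}"

definition Lp_norm :: "real \<Rightarrow> (real \<Rightarrow> 'a::real_normed_vector) \<Rightarrow> real" where
  "Lp_norm p f = (LINT x|lebesgue. norm (f x) powr p) powr (1 / p)"

definition gauss_weight :: "real \<Rightarrow> real" where
  "gauss_weight y = exp (- (1/2) * y\<^sup>2)"

definition conv_kernel :: "real \<Rightarrow> real \<Rightarrow> real \<Rightarrow> real" where
  "conv_kernel x u v =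
     exp (- (1/2) * (x + u + v)\<^sup>2) + exp (- (1/2) * (x + u - v)\<^sup>2)
   + exp (- (1/2) * (x - u + v)\<^sup>2) + exp (- (1/2) * (x - u - v)\<^sup>2)"

definition conv_integrand ::
  "(real \<Rightarrow> complex) \<Rightarrow> (real \<Rightarrow> complex) \<Rightarrow> real \<Rightarrow> real \<times> real \<Rightarrow> complex" where
  "conv_integrand f g x = (\<lambda>(u, v). f u * g v * complex_of_real (conv_kernel x u v))"

text \<open>The integral is the Lebesgue integral over the plane; like every Bochner integral in the
  library it is 0 by convention where the integrand is not integrable.\<close>

definition cosine_conv ::
  "(real \<Rightarrow> complex) \<Rightarrow> (real \<Rightarrow> complex) \<Rightarrow> real \<Rightarrow> complex" where
  "cosine_conv f g x =
     complex_of_real (1 / (8 * pi)) * (LINT w|lebesgue. conv_integrand f g x w)"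

end

theory Submission
  imports Defs "HOL-Probability.Distributions"
begin

text \<open>The kernel is a sum of four terms \<open>\<gamma> (x \<plusminus> u \<plusminus> v)\<close>, so everything rests on a Young inequality for
  four functions evaluated at \<open>u\<close>, \<open>v\<close>, \<open>x\<close> and \<open>x \<plusminus> u \<plusminus> v\<close>. Write the functions as powers
  \<open>a\<^sub>i powr \<theta>\<^sub>i\<close> with \<open>\<integral> a\<^sub>i \<le> 1\<close> and \<open>\<Sum> \<theta>\<^sub>i = 3\<close>. The weights \<open>1 - \<theta>\<^sub>i\<close> sum to 1, and
  \<open>\<Prod> a\<^sub>i powr \<theta>\<^sub>i = \<Prod>\<^sub>i (\<Prod>\<^bsub>j \<noteq> i\<^esub> a\<^sub>j) powr (1 - \<theta>\<^sub>i)\<close>, so weighted AM-GM bounds the product by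
  \<open>\<Sum>\<^sub>i (1 - \<theta>\<^sub>i) * \<Prod>\<^bsub>j \<noteq> i\<^esub> a\<^sub>j\<close>. Any three of the four linear forms are unimodular coordinates on the
  space of \<open>(x, u, v)\<close>, so each summand integrates to at most its weight. The same argument with
  three functions and \<open>\<Sum> \<theta>\<^sub>i = 2\<close> gives absolute convergence of the convolution at every single
  \<open>x\<close>, because the Gaussian lies in every \<open>L\<^sub>t\<close>.\<close>


section \<open>Weighted AM-GM for products of powers\<close>

lemma prod_powr_le_sum_prod:
  fixes a \<theta> :: "'i \<Rightarrow> real"
  assumes "finite I" and a: "\<And>i. i \<in> I \<Longrightarrow> 0 \<le> a i" and \<theta>: "\<And>i. i \<in> I \<Longrightarrow> \<theta> i \<le> 1"
    and sum: "(\<Sum>i\<in>I. 1 - \<theta> i) = 1"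
  shows "(\<Prod>i\<in>I. a i powr \<theta> i) \<le> (\<Sum>i\<in>I. (1 - \<theta> i) * (\<Prod>j\<in>I-{i}. a j))"
\<comment> \<open>A zero factor makes the left side 0, because \<open>0 powr t = 0\<close> for every
  exponent \<open>t\<close>, even \<open>t = 0\<close>; otherwise logarithms are available.\<close>
proof (cases "\<exists>i\<in>I. a i = 0")
  case True
  then have "(\<Prod>i\<in>I. a i powr \<theta> i) = 0"
    using \<open>finite I\<close> by auto
  moreover have "0 \<le> (\<Sum>i\<in>I. (1 - \<theta> i) * (\<Prod>j\<in>I-{i}. a j))"
    using a \<theta> by (intro sum_nonneg mult_nonneg_nonneg prod_nonneg) auto
  ultimately show ?thesis by simp
next
  case False
  then have pos: "0 < a i" if "i \<in> I" for i
    using a[OF that] that by (auto simp: less_le)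
  have "I \<noteq> {}" using sum by auto
  \<comment> \<open>With \<open>L\<close> the sum of all logarithms, the product omitting index
    \<open>i\<close> is \<open>exp (L - ln (a i))\<close>. As the weights
    \<open>1 - \<theta> i\<close> sum to 1, the logarithm of the left side is the weighted mean of
    the numbers \<open>L - ln (a i)\<close>, and convexity of \<open>exp\<close> finishes.\<close>
  define L where "L = (\<Sum>j\<in>I. ln (a j))"
  have prod_eq: "(\<Prod>j\<in>I-{i}. a j) = exp (L - ln (a i))" if "i \<in> I" for i
  proof -
    have "exp (L - ln (a i)) = exp (\<Sum>j\<in>I-{i}. ln (a j))"
      using that \<open>finite I\<close> by (simp add: L_def sum_diff1)
    also have "\<dots> = (\<Prod>j\<in>I-{i}. a j)"
      using \<open>finite I\<close> pos by (subst exp_sum) (auto intro!: prod.cong)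
    finally show ?thesis ..
  qed
  have "(\<Prod>i\<in>I. a i powr \<theta> i) = exp (\<Sum>i\<in>I. \<theta> i * ln (a i))"
    unfolding exp_sum[OF \<open>finite I\<close>] by (intro prod.cong refl) (use pos in \<open>force simp: powr_def\<close>)
  also have "(\<Sum>i\<in>I. \<theta> i * ln (a i)) = L - (\<Sum>i\<in>I. (1 - \<theta> i) * ln (a i))"
    by (simp add: L_def left_diff_distrib sum_subtractf)
  also have "L = (\<Sum>i\<in>I. (1 - \<theta> i) * L)"
    by (simp add: sum flip: sum_distrib_right)
  also have "\<dots> - (\<Sum>i\<in>I. (1 - \<theta> i) * ln (a i)) = (\<Sum>i\<in>I. (1 - \<theta> i) *\<^sub>R (L - ln (a i)))"
    by (simp add: right_diff_distrib sum_subtractf)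
  also have "exp \<dots> \<le> (\<Sum>i\<in>I. (1 - \<theta> i) * exp (L - ln (a i)))"
    using \<open>finite I\<close> \<open>I \<noteq> {}\<close> exp_convex sum \<theta> by (intro convex_on_sum) auto
  also have "\<dots> = (\<Sum>i\<in>I. (1 - \<theta> i) * (\<Prod>j\<in>I-{i}. a j))"
    by (intro sum.cong) (auto simp: prod_eq)
  finally show ?thesis .
qed

lemma powr_mult3_le:
  fixes x y z a b c :: real
  assumes "0 \<le> x" "0 \<le> y" "0 \<le> z" "a \<le> 1" "b \<le> 1" "c \<le> 1" "a + b + c = 2"
  shows "x powr a * y powr b * z powr c
    \<le> (1 - a) * (y * z) + (1 - b) * (x * z) + (1 - c) * (x * y)"
proof -
  let ?I = "{0, 1, 2 :: nat}"
  let ?f = "\<lambda>u v w (i::nat). if i = 0 then u else if i = 1 then v else (w::real)"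
  have D: "?I - {0} = {1, 2}" "?I - {Suc 0} = {0, 2}" "?I - {2} = {0, 1}" by auto
  have "(\<Prod>i\<in>?I. ?f x y z i powr ?f a b c i)
      \<le> (\<Sum>i\<in>?I. (1 - ?f a b c i) * (\<Prod>j\<in>?I - {i}. ?f x y z j))"
    using assms by (intro prod_powr_le_sum_prod) auto
  then show ?thesis
    using D by (simp add: mult.assoc add.assoc)
qed

lemma powr_mult4_le:
  fixes x y z w a b c d :: real
  assumes "0 \<le> x" "0 \<le> y" "0 \<le> z" "0 \<le> w" "a \<le> 1" "b \<le> 1" "c \<le> 1" "d \<le> 1" "a + b + c + d = 3"
  shows "x powr a * y powr b * z powr c * w powr d
    \<le> (1 - a) * (y * z * w) + (1 - b) * (x * z * w) + (1 - c) * (x * y * w) + (1 - d) * (x * y * z)"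
proof -
  let ?I = "{0, 1, 2, 3 :: nat}"
  let ?f = "\<lambda>u v w t (i::nat). if i = 0 then u else if i = 1 then v else if i = 2 then w else (t::real)"
  have D: "?I - {0} = {1, 2, 3}" "?I - {Suc 0} = {0, 2, 3}" "?I - {2} = {0, 1, 3}" "?I - {3} = {0, 1, 2}"
    by auto
  have "(\<Prod>i\<in>?I. ?f x y z w i powr ?f a b c d i)
      \<le> (\<Sum>i\<in>?I. (1 - ?f a b c d i) * (\<Prod>j\<in>?I - {i}. ?f x y z w j))"
    using assms by (intro prod_powr_le_sum_prod) auto
  then show ?thesis
    using D by (simp add: mult.assoc add.assoc)
qed

section \<open>Integrals in unimodular coordinates\<close>

lemma nn_integral_lborel_shift:
  fixes f :: "real \<Rightarrow> ennreal"
  assumes "f \<in> borel_measurable borel" "\<bar>c\<bar> = 1"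
  shows "(\<integral>\<^sup>+x. f (t + c * x) \<partial>lborel) = (\<integral>\<^sup>+x. f x \<partial>lborel)"
  using nn_integral_real_affine[OF assms(1), of c t] assms(2) by auto

lemma nn_integral_tensor:
  fixes F G :: "real \<Rightarrow> ennreal"
  assumes [measurable]: "F \<in> borel_measurable borel" "G \<in> borel_measurable borel"
  shows "(\<integral>\<^sup>+u. \<integral>\<^sup>+v. F u * G v \<partial>lborel \<partial>lborel) = (\<integral>\<^sup>+u. F u \<partial>lborel) * (\<integral>\<^sup>+v. G v \<partial>lborel)"
  by (simp add: nn_integral_cmult nn_integral_multc)

text \<open>For fixed \<open>u\<close> the argument of \<open>K\<close> is affine in
  \<open>v\<close> with slope \<tau> of modulus 1, so the inner integral is \<open>F u\<close> times
  a constant independent of \<open>u\<close>.\<close>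

lemma nn_integral_shift_snd:
  fixes F K :: "real \<Rightarrow> ennreal"
  assumes [measurable]: "F \<in> borel_measurable borel" "K \<in> borel_measurable borel"
    and "\<bar>\<tau>\<bar> = 1"
  shows "(\<integral>\<^sup>+u. \<integral>\<^sup>+v. F u * K (x + \<sigma> * u + \<tau> * v) \<partial>lborel \<partial>lborel)
    = (\<integral>\<^sup>+u. F u \<partial>lborel) * (\<integral>\<^sup>+v. K v \<partial>lborel)"
  using \<open>\<bar>\<tau>\<bar> = 1\<close> by (simp add: nn_integral_cmult nn_integral_multc nn_integral_lborel_shift)

text \<open>Tonelli exchanges the roles of \<open>u\<close> and \<open>v\<close>, which reduces this
  to the previous situation with \<sigma> as the slope.\<close>

lemma nn_integral_shift_fst:
  fixes G K :: "real \<Rightarrow> ennreal"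
  assumes [measurable]: "G \<in> borel_measurable borel" "K \<in> borel_measurable borel"
    and "\<bar>\<sigma>\<bar> = 1"
  shows "(\<integral>\<^sup>+u. \<integral>\<^sup>+v. G v * K (x + \<sigma> * u + \<tau> * v) \<partial>lborel \<partial>lborel)
    = (\<integral>\<^sup>+v. G v \<partial>lborel) * (\<integral>\<^sup>+u. K u \<partial>lborel)"
proof -
  have "(\<integral>\<^sup>+u. \<integral>\<^sup>+v. G v * K (x + \<sigma> * u + \<tau> * v) \<partial>lborel \<partial>lborel)
      = (\<integral>\<^sup>+v. \<integral>\<^sup>+u. G v * K (x + \<tau> * v + \<sigma> * u) \<partial>lborel \<partial>lborel)"
    by (subst lborel_pair.Fubini') (simp_all add: algebra_simps)
  then show ?thesis
    using \<open>\<bar>\<sigma>\<bar> = 1\<close> by (simp add: nn_integral_shift_snd)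
qed

text \<open>Two Tonelli swaps make \<open>x\<close> the innermost variable; it occurs only inside
  \<open>K\<close>, with coefficient 1, so its integral is translation invariant and factors
  out.\<close>

lemma nn_integral_shift_trd:
  fixes F G K :: "real \<Rightarrow> ennreal"
  assumes [measurable]: "F \<in> borel_measurable borel" "G \<in> borel_measurable borel"
      "K \<in> borel_measurable borel"
  shows "(\<integral>\<^sup>+x. \<integral>\<^sup>+u. \<integral>\<^sup>+v. F u * G v * K (x + \<sigma> * u + \<tau> * v) \<partial>lborel \<partial>lborel \<partial>lborel)
    = (\<integral>\<^sup>+u. F u \<partial>lborel) * (\<integral>\<^sup>+v. G v \<partial>lborel) * (\<integral>\<^sup>+x. K x \<partial>lborel)"
proof -
  have "(\<integral>\<^sup>+x. \<integral>\<^sup>+u. \<integral>\<^sup>+v. F u * G v * K (x + \<sigma> * u + \<tau> * v) \<partial>lborel \<partial>lborel \<partial>lborel)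
      = (\<integral>\<^sup>+u. \<integral>\<^sup>+x. \<integral>\<^sup>+v. F u * G v * K (x + \<sigma> * u + \<tau> * v) \<partial>lborel \<partial>lborel \<partial>lborel)"
    by (subst lborel_pair.Fubini') simp_all
  also have "\<dots> = (\<integral>\<^sup>+u. \<integral>\<^sup>+v. \<integral>\<^sup>+x. F u * G v * K ((\<sigma> * u + \<tau> * v) + 1 * x) \<partial>lborel \<partial>lborel \<partial>lborel)"
    by (subst lborel_pair.Fubini') (simp_all add: algebra_simps)
  also have "\<dots> = (\<integral>\<^sup>+u. \<integral>\<^sup>+v. F u * G v * (\<integral>\<^sup>+x. K x \<partial>lborel) \<partial>lborel \<partial>lborel)"
    by (subst nn_integral_cmult, simp, subst nn_integral_lborel_shift) simp_all
  finally show ?thesis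
    by (simp add: nn_integral_cmult nn_integral_multc)
qed

section \<open>Young inequalities for three and four functions\<close>

lemma ennreal_convex_comb_le_one:
  assumes "a \<ge> 0" "b \<ge> 0" "c \<ge> 0" "d \<ge> 0" "a + b + c + d = 1"
    and "X \<le> 1" "Y \<le> 1" "Z \<le> 1" "W \<le> (1::ennreal)"
  shows "ennreal a * X + ennreal b * Y + ennreal c * Z + ennreal d * W \<le> 1"
proof -
  have "ennreal a * X + ennreal b * Y + ennreal c * Z + ennreal d * W
      \<le> ennreal a * 1 + ennreal b * 1 + ennreal c * 1 + ennreal d * 1"
    using assms by (intro add_mono mult_left_mono) auto
  also have "\<dots> = 1"
    using assms by (simp flip: ennreal_plus)
  finally show ?thesis .
qed

text \<open>Serves the absolute convergence of the convolution at a fixed \<open>x\<close>, for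
  which finiteness is enough. After AM-GM every summand contains two of the three functions, and its
  double integral is a product of two finite integrals.\<close>

lemma young_three_finite:
  fixes F G K :: "real \<Rightarrow> real"
  assumes [measurable]: "F \<in> borel_measurable borel" "G \<in> borel_measurable borel"
      "K \<in> borel_measurable borel"
    and nonneg: "\<And>u. 0 \<le> F u" "\<And>u. 0 \<le> G u" "\<And>u. 0 \<le> K u"
    and exps: "a \<le> 1" "b \<le> 1" "c \<le> 1" "a + b + c = 2"
    and signs: "\<bar>\<sigma>\<bar> = 1" "\<bar>\<tau>\<bar> = 1"
    and fin: "(\<integral>\<^sup>+u. F u \<partial>lborel) < \<infinity>" "(\<integral>\<^sup>+u. G u \<partial>lborel) < \<infinity>" "(\<integral>\<^sup>+u. K u \<partial>lborel) < \<infinity>"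
  shows "(\<integral>\<^sup>+u. \<integral>\<^sup>+v. ennreal (F u powr a * G v powr b * K (x + \<sigma> * u + \<tau> * v) powr c)
    \<partial>lborel \<partial>lborel) < \<infinity>"
proof -
  let ?K = "\<lambda>u v. K (x + \<sigma> * u + \<tau> * v)"
  have "(\<integral>\<^sup>+u. \<integral>\<^sup>+v. ennreal (F u powr a * G v powr b * ?K u v powr c) \<partial>lborel \<partial>lborel)
     \<le> (\<integral>\<^sup>+u. \<integral>\<^sup>+v. ennreal (1 - a) * (ennreal (G v) * ennreal (?K u v))
         + ennreal (1 - b) * (ennreal (F u) * ennreal (?K u v))
         + ennreal (1 - c) * (ennreal (F u) * ennreal (G v)) \<partial>lborel \<partial>lborel)"
  proof (intro nn_integral_mono)
    fix u v
    have "ennreal (F u powr a * G v powr b * ?K u v powr c)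
      \<le> ennreal ((1 - a) * (G v * ?K u v) + (1 - b) * (F u * ?K u v) + (1 - c) * (F u * G v))"
      using nonneg exps by (intro ennreal_leI powr_mult3_le) auto
    also have "\<dots> = ennreal (1 - a) * (ennreal (G v) * ennreal (?K u v))
         + ennreal (1 - b) * (ennreal (F u) * ennreal (?K u v))
         + ennreal (1 - c) * (ennreal (F u) * ennreal (G v))"
      using nonneg exps by (simp add: ennreal_mult)
    finally show "ennreal (F u powr a * G v powr b * ?K u v powr c) \<le> \<dots>" .
  qed
  also have "\<dots> = ennreal (1 - a) * ((\<integral>\<^sup>+u. G u \<partial>lborel) * (\<integral>\<^sup>+u. K u \<partial>lborel))
      + ennreal (1 - b) * ((\<integral>\<^sup>+u. F u \<partial>lborel) * (\<integral>\<^sup>+u. K u \<partial>lborel))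
      + ennreal (1 - c) * ((\<integral>\<^sup>+u. F u \<partial>lborel) * (\<integral>\<^sup>+u. G u \<partial>lborel))"
    using signs
    by (simp add: nn_integral_add nn_integral_cmult[of _ lborel "ennreal (1 - _)"] nn_integral_tensor
      nn_integral_shift_snd[where K = "\<lambda>t. ennreal (K t)"]
      nn_integral_shift_fst[where K = "\<lambda>t. ennreal (K t)"])
  also have "\<dots> < \<infinity>"
    using fin by (simp add: ennreal_mult_less_top)
  finally show ?thesis .
qed

text \<open>AM-GM with weights \<open>1 - a\<close>, \<open>1 - b\<close>, \<open>1 - c\<close>,
  \<open>1 - d\<close>, whose sum is \<open>4 - 3 = 1\<close>: every summand integrates to a product
  of three numbers at most 1, so the total is a convex combination of such products.\<close>

lemma young_four_normalized:
  fixes F G H K :: "real \<Rightarrow> real"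
  assumes [measurable]: "F \<in> borel_measurable borel" "G \<in> borel_measurable borel"
      "H \<in> borel_measurable borel" "K \<in> borel_measurable borel"
    and nonneg: "\<And>u. 0 \<le> F u" "\<And>u. 0 \<le> G u" "\<And>u. 0 \<le> H u" "\<And>u. 0 \<le> K u"
    and exps: "a \<le> 1" "b \<le> 1" "c \<le> 1" "d \<le> 1" "a + b + c + d = 3"
    and signs: "\<bar>\<sigma>\<bar> = 1" "\<bar>\<tau>\<bar> = 1"
    and le: "(\<integral>\<^sup>+u. F u \<partial>lborel) \<le> 1" "(\<integral>\<^sup>+u. G u \<partial>lborel) \<le> 1"
      "(\<integral>\<^sup>+u. H u \<partial>lborel) \<le> 1" "(\<integral>\<^sup>+u. K u \<partial>lborel) \<le> 1"
  shows "(\<integral>\<^sup>+x. \<integral>\<^sup>+u. \<integral>\<^sup>+v.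
      ennreal (F u powr a * G v powr b * H x powr c * K (x + \<sigma> * u + \<tau> * v) powr d)
    \<partial>lborel \<partial>lborel \<partial>lborel) \<le> 1"
proof -
  let ?K = "\<lambda>x u v. K (x + \<sigma> * u + \<tau> * v)"
  have "(\<integral>\<^sup>+x. \<integral>\<^sup>+u. \<integral>\<^sup>+v. ennreal (F u powr a * G v powr b * H x powr c * ?K x u v powr d)
       \<partial>lborel \<partial>lborel \<partial>lborel)
     \<le> (\<integral>\<^sup>+x. \<integral>\<^sup>+u. \<integral>\<^sup>+v. ennreal (1 - a) * (ennreal (H x) * (ennreal (G v) * ennreal (?K x u v)))
         + ennreal (1 - b) * (ennreal (H x) * (ennreal (F u) * ennreal (?K x u v)))
         + ennreal (1 - c) * (ennreal (F u) * ennreal (G v) * ennreal (?K x u v))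
         + ennreal (1 - d) * (ennreal (H x) * (ennreal (F u) * ennreal (G v))) \<partial>lborel \<partial>lborel \<partial>lborel)"
  proof (intro nn_integral_mono)
    fix x u v
    have "ennreal (F u powr a * G v powr b * H x powr c * ?K x u v powr d)
      \<le> ennreal ((1 - a) * (G v * H x * ?K x u v) + (1 - b) * (F u * H x * ?K x u v)
        + (1 - c) * (F u * G v * ?K x u v) + (1 - d) * (F u * G v * H x))"
      using nonneg exps by (intro ennreal_leI powr_mult4_le) auto
    also have "\<dots> = ennreal (1 - a) * (ennreal (H x) * (ennreal (G v) * ennreal (?K x u v)))
         + ennreal (1 - b) * (ennreal (H x) * (ennreal (F u) * ennreal (?K x u v)))
         + ennreal (1 - c) * (ennreal (F u) * ennreal (G v) * ennreal (?K x u v))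
         + ennreal (1 - d) * (ennreal (H x) * (ennreal (F u) * ennreal (G v)))"
      using nonneg exps by (simp add: ennreal_mult mult_ac)
    finally show "ennreal (F u powr a * G v powr b * H x powr c * ?K x u v powr d) \<le> \<dots>" .
  qed
  \<comment> \<open>Where \<open>H x\<close> is present it leaves the two inner integrals, which
    then factor for each \<open>x\<close>. The summand with weight \<open>1 - c\<close> lacks
    \<open>H\<close>, so there the integration over \<open>x\<close> has to be spent on
    \<open>K\<close>.\<close>
  also have "\<dots> = ennreal (1 - a) * ((\<integral>\<^sup>+x. H x \<partial>lborel) * ((\<integral>\<^sup>+u. G u \<partial>lborel) * (\<integral>\<^sup>+u. K u \<partial>lborel)))
      + ennreal (1 - b) * ((\<integral>\<^sup>+x. H x \<partial>lborel) * ((\<integral>\<^sup>+u. F u \<partial>lborel) * (\<integral>\<^sup>+u. K u \<partial>lborel)))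
      + ennreal (1 - c) * ((\<integral>\<^sup>+u. F u \<partial>lborel) * (\<integral>\<^sup>+u. G u \<partial>lborel) * (\<integral>\<^sup>+u. K u \<partial>lborel))
      + ennreal (1 - d) * ((\<integral>\<^sup>+x. H x \<partial>lborel) * ((\<integral>\<^sup>+u. F u \<partial>lborel) * (\<integral>\<^sup>+u. G u \<partial>lborel)))"
    using signs
    by (simp add: nn_integral_add nn_integral_cmult[of _ lborel "ennreal (1 - _)"]
      nn_integral_cmult[of _ lborel "ennreal (H _)"] nn_integral_multc nn_integral_tensor
      nn_integral_shift_snd[where K = "\<lambda>t. ennreal (K t)"]
      nn_integral_shift_fst[where K = "\<lambda>t. ennreal (K t)"]
      nn_integral_shift_trd[where K = "\<lambda>t. ennreal (K t)"])
  also have "\<dots> \<le> 1"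
    using exps le by (intro ennreal_convex_comb_le_one mult_le_one) auto
  finally show ?thesis .
qed

lemma gauss_weight_powr: "gauss_weight y powr r = exp (- (r * y\<^sup>2 / 2))"
  by (simp add: gauss_weight_def powr_def)

text \<open>\<open>gauss_weight y powr r\<close> is a multiple of the normal density of mean 0 and
  variance \<open>1 / r\<close>, and the multiple is the value of the integral. Its power with
  exponent \<open>1 / r\<close> is the \<open>L_r\<close> norm of the Gaussian, which is the
  constant of the theorem.\<close>

lemma has_bochner_integral_gauss_weight_powr:
  assumes "0 < r"
  shows "has_bochner_integral lborel (\<lambda>y. gauss_weight y powr r) (sqrt (2 * pi / r))"
proof -
  have eq: "gauss_weight y powr r = sqrt (2 * pi / r) * normal_density 0 (1 / sqrt r) y" for y
    using assms by (simp add: gauss_weight_powr normal_density_def power_divide field_simps real_sqrt_divide)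
  have "has_bochner_integral lborel (normal_density 0 (1 / sqrt r)) 1"
    using assms by (simp add: has_bochner_integral_iff)
  from has_bochner_integral_mult_right[OF this, of "sqrt (2 * pi / r)"] show ?thesis
    unfolding eq by simp
qed

text \<open>Both sides are homogeneous: dividing \<open>F\<close>, \<open>G\<close>,
  \<open>H\<close>, \<open>K\<close> by \<open>A\<close>, \<open>B\<close>, \<open>C\<close>,
  \<open>D\<close> normalizes the integrals and pulls the constant out of the integrand
  pointwise.\<close>

lemma young_four_pos:
  fixes F G H K :: "real \<Rightarrow> real"
  assumes [measurable]: "F \<in> borel_measurable borel" "G \<in> borel_measurable borel"
      "H \<in> borel_measurable borel" "K \<in> borel_measurable borel"
    and nonneg: "\<And>u. 0 \<le> F u" "\<And>u. 0 \<le> G u" "\<And>u. 0 \<le> H u" "\<And>u. 0 \<le> K u"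
    and exps: "a \<le> 1" "b \<le> 1" "c \<le> 1" "d \<le> 1" "a + b + c + d = 3"
    and signs: "\<bar>\<sigma>\<bar> = 1" "\<bar>\<tau>\<bar> = 1"
    and pos: "0 < A" "0 < B" "0 < C" "0 < D"
    and le: "(\<integral>\<^sup>+u. F u \<partial>lborel) \<le> ennreal A" "(\<integral>\<^sup>+u. G u \<partial>lborel) \<le> ennreal B"
      "(\<integral>\<^sup>+u. H u \<partial>lborel) \<le> ennreal C" "(\<integral>\<^sup>+u. K u \<partial>lborel) \<le> ennreal D"
  shows "(\<integral>\<^sup>+x. \<integral>\<^sup>+u. \<integral>\<^sup>+v.
      ennreal (F u powr a * G v powr b * H x powr c * K (x + \<sigma> * u + \<tau> * v) powr d)
    \<partial>lborel \<partial>lborel \<partial>lborel) \<le> ennreal (A powr a * B powr b * C powr c * D powr d)"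
proof -
  let ?P = "A powr a * B powr b * C powr c * D powr d"
  let ?I = "\<lambda>F G H K. \<integral>\<^sup>+x. \<integral>\<^sup>+u. \<integral>\<^sup>+v.
      ennreal (F u powr a * G v powr b * H x powr c * K (x + \<sigma> * u + \<tau> * v) powr d)
    \<partial>lborel \<partial>lborel \<partial>lborel"
  have scaled: "(\<integral>\<^sup>+u. ennreal (f u / M) \<partial>lborel) \<le> 1"
    if "(\<integral>\<^sup>+u. ennreal (f u) \<partial>lborel) \<le> ennreal M" "0 < M"
      "f \<in> borel_measurable borel" "\<And>u. 0 \<le> f u" for f :: "real \<Rightarrow> real" and M
  proof -
    have "(\<integral>\<^sup>+u. ennreal (f u / M) \<partial>lborel) = (\<integral>\<^sup>+u. ennreal (f u) \<partial>lborel) / ennreal M"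
      using that by (simp add: nn_integral_divide flip: divide_ennreal)
    also have "\<dots> \<le> ennreal M / ennreal M"
      using that by (intro divide_right_mono_ennreal)
    finally show ?thesis
      using that by (simp add: divide_ennreal)
  qed
  have "ennreal (F u powr a * G v powr b * H x powr c * K y powr d) = ennreal ?P *
     ennreal ((F u / A) powr a * (G v / B) powr b * (H x / C) powr c * (K y / D) powr d)" for x u v y
    using pos nonneg by (simp add: powr_divide flip: ennreal_mult)
  then have "?I F G H K = ennreal ?P * ?I (\<lambda>u. F u / A) (\<lambda>u. G u / B) (\<lambda>u. H u / C) (\<lambda>u. K u / D)"
    by (simp add: nn_integral_cmult)
  also have "\<dots> \<le> ennreal ?P * 1"
    using pos nonneg exps signs le by (intro mult_left_mono young_four_normalized scaled) auto
  finally show ?thesis by simp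
qed

lemma young_four:
  fixes F G H K :: "real \<Rightarrow> real"
  assumes meas: "F \<in> borel_measurable borel" "G \<in> borel_measurable borel"
      "H \<in> borel_measurable borel" "K \<in> borel_measurable borel"
    and nonneg: "\<And>u. 0 \<le> F u" "\<And>u. 0 \<le> G u" "\<And>u. 0 \<le> H u" "\<And>u. 0 \<le> K u"
    and exps: "0 < a" "0 < b" "0 < c" "0 < d" "a \<le> 1" "b \<le> 1" "c \<le> 1" "d \<le> 1" "a + b + c + d = 3"
    and signs: "\<bar>\<sigma>\<bar> = 1" "\<bar>\<tau>\<bar> = 1"
    and bounds: "0 \<le> A" "0 \<le> B" "0 \<le> C" "0 \<le> D"
    and le: "(\<integral>\<^sup>+u. F u \<partial>lborel) \<le> ennreal A" "(\<integral>\<^sup>+u. G u \<partial>lborel) \<le> ennreal B"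
      "(\<integral>\<^sup>+u. H u \<partial>lborel) \<le> ennreal C" "(\<integral>\<^sup>+u. K u \<partial>lborel) \<le> ennreal D"
  shows "(\<integral>\<^sup>+x. \<integral>\<^sup>+u. \<integral>\<^sup>+v.
      ennreal (F u powr a * G v powr b * H x powr c * K (x + \<sigma> * u + \<tau> * v) powr d)
    \<partial>lborel \<partial>lborel \<partial>lborel) \<le> ennreal (A powr a * B powr b * C powr c * D powr d)"
    (is "?I \<le> _")
proof (rule tendsto_lowerbound)
  \<comment> \<open>Some of the bounds may vanish, which excludes normalization; add \<open>e > 0\<close> and let it tend to 0.\<close>
  let ?R = "\<lambda>e. ennreal ((A + e) powr a * (B + e) powr b * (C + e) powr c * (D + e) powr d)"
  \<comment> \<open>At \<open>M = 0\<close> this convergence relies on \<open>0 < m\<close>: then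
    \<open>e powr m\<close> tends to \<open>0 = 0 powr m\<close>.\<close>
  have lim: "((\<lambda>e. (M + e) powr m) \<longlongrightarrow> M powr m) (at_right 0)" if "0 \<le> M" "0 < m" for M m :: real
  proof (rule tendsto_powr2)
    show "((+) M \<longlongrightarrow> M) (at_right 0)"
      by (auto intro!: tendsto_eq_intros)
    show "\<forall>\<^sub>F e in at_right 0. 0 \<le> M + e"
      using eventually_at_right_less[of "0::real"] by eventually_elim (use \<open>0 \<le> M\<close> in simp)
  qed (use \<open>0 < m\<close> in auto)
  show "(?R \<longlongrightarrow> ennreal (A powr a * B powr b * C powr c * D powr d)) (at_right 0)"
    using bounds exps by (intro tendsto_ennrealI tendsto_mult lim)
  show "\<forall>\<^sub>F e in at_right 0. ?I \<le> ?R e"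
    using eventually_at_right_less[of "0::real"]
  proof eventually_elim
    case (elim e)
    have mono: "ennreal M \<le> ennreal (M + e)" for M
      using elim by (intro ennreal_leI) simp
    show ?case
      using elim bounds
      by (intro young_four_pos meas nonneg exps signs le[THEN order_trans] mono) auto
  qed
qed simp

section \<open>Borel representatives of Lebesgue measurable functions\<close>

text \<open>The Young inequalities are about Borel functions and \<open>lborel\<close>, whereas
  members of \<open>Lp_space\<close> are only Lebesgue measurable. Real and imaginary part each
  agree almost everywhere with a Borel function, and this changes no integral of
  \<open>norm (f x) powr p\<close>.\<close>

lemma Lp_space_borel_representative:
  fixes f :: "real \<Rightarrow> complex"
  assumes "f \<in> Lp_space p"
  obtains f' where "f' \<in> borel_measurable borel" "AE x in lborel. f x = f' x"
    "(\<integral>\<^sup>+x. ennreal (norm (f' x) powr p) \<partial>lborel) = ennreal (LINT x|lebesgue. norm (f x) powr p)"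
proof -
  have f: "f \<in> borel_measurable lebesgue" and int: "integrable lebesgue (\<lambda>x. norm (f x) powr p)"
    using assms by (auto simp: Lp_space_def)
  have "(\<lambda>x. Re (f x)) \<in> borel_measurable lebesgue" "(\<lambda>x. Im (f x)) \<in> borel_measurable lebesgue"
    using f by simp_all
  then obtain g1 g2 where g: "g1 \<in> borel_measurable lborel" "AE x in lborel. Re (f x) = g1 x"
     "g2 \<in> borel_measurable lborel" "AE x in lborel. Im (f x) = g2 x"
    using completion_ex_borel_measurable_real by metis
  define f' where "f' x = Complex (g1 x) (g2 x)" for x
  have f': "f' \<in> borel_measurable borel"
    using g by (simp add: f'_def borel_measurable_complex_iff)
  have eq: "AE x in lborel. f x = f' x"
    using g(2,4) by eventually_elim (simp add: f'_def complex_eq_iff)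
  have "(\<integral>\<^sup>+x. ennreal (norm (f' x) powr p) \<partial>lborel) = (\<integral>\<^sup>+x. ennreal (norm (f x) powr p) \<partial>lborel)"
    using eq by (intro nn_integral_cong_AE) (auto elim: eventually_mono)
  also have "\<dots> = ennreal (LINT x|lebesgue. norm (f x) powr p)"
    using nn_integral_eq_integral[OF int] by (simp add: nn_integral_completion)
  finally show thesis
    using that f' eq by blast
qed

section \<open>The Gaussian weight and the convolution kernel\<close>

lemma gauss_weight_measurable [measurable]: "gauss_weight \<in> borel_measurable borel"
  unfolding gauss_weight_def[abs_def] by measurable

lemma gauss_weight_nonneg: "0 \<le> gauss_weight y"
  by (simp add: gauss_weight_def)

lemma nn_integral_gauss_weight_powr:
  assumes "0 < r"
  shows "(\<integral>\<^sup>+y. ennreal (gauss_weight y powr r) \<partial>lborel) = ennreal (sqrt (2 * pi / r))"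
  using has_bochner_integral_gauss_weight_powr[OF assms]
  by (simp add: has_bochner_integral_iff nn_integral_eq_integral)

text \<open>Allows each estimate to be proved once, for a generic pair of signs, and then
  summed.\<close>

lemma conv_kernel_eq_sum:
  "conv_kernel x u v = (\<Sum>\<sigma>\<in>{1, -1}. \<Sum>\<tau>\<in>{1, -1}. gauss_weight (x + \<sigma> * u + \<tau> * v))"
  by (simp add: conv_kernel_def gauss_weight_def algebra_simps)

lemma ennreal_mult_conv_kernel:
  assumes "0 \<le> m"
  shows "ennreal (m * conv_kernel x u v)
    = (\<Sum>\<sigma>\<in>{1, -1}. \<Sum>\<tau>\<in>{1, -1}. ennreal (m * gauss_weight (x + \<sigma> * u + \<tau> * v)))"
  using assms gauss_weight_nonneg
  by (simp add: conv_kernel_eq_sum sum_distrib_left distrib_left)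

lemma conv_kernel_nonneg: "0 \<le> conv_kernel x u v"
  by (simp add: conv_kernel_def)

lemma conv_kernel_measurable [measurable (raw)]:
  assumes [measurable]: "f \<in> borel_measurable M" "g \<in> borel_measurable M" "h \<in> borel_measurable M"
  shows "(\<lambda>w. conv_kernel (f w) (g w) (h w)) \<in> borel_measurable M"
  unfolding conv_kernel_def by measurable

lemma nn_integral_conv_kernel_finite:
  fixes f g :: "real \<Rightarrow> real"
  assumes [measurable]: "f \<in> borel_measurable borel" "g \<in> borel_measurable borel"
    and nonneg: "\<And>u. 0 \<le> f u" "\<And>u. 0 \<le> g u"
    and exps: "1 \<le> p" "1 \<le> q" "1 \<le> 1/p + 1/q" "1/p + 1/q < 2"
    and fin: "(\<integral>\<^sup>+u. f u powr p \<partial>lborel) < \<infinity>" "(\<integral>\<^sup>+u. g u powr q \<partial>lborel) < \<infinity>"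
  shows "(\<integral>\<^sup>+u. \<integral>\<^sup>+v. ennreal (f u * g v * conv_kernel x u v) \<partial>lborel \<partial>lborel) < \<infinity>"
proof -
  \<comment> \<open>The exponent that completes \<open>1/p\<close> and \<open>1/q\<close> to the sum
    2 of the three-function inequality. The assumptions on \<open>1/p + 1/q\<close> say exactly that
    \<open>0 < c\<close> and \<open>c \<le> 1\<close>; the Gaussian is then used as a member of
    \<open>L_t\<close> with \<open>t = 1/c\<close>.\<close>
  define c where "c = 2 - 1/p - 1/q"
  have c: "0 < c" "c \<le> 1" using exps by (auto simp: c_def)
  have term_finite: "(\<integral>\<^sup>+u. \<integral>\<^sup>+v. ennreal (f u * g v * gauss_weight (x + \<sigma> * u + \<tau> * v)) \<partial>lborel \<partial>lborel) < \<infinity>"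
    if "\<bar>\<sigma>\<bar> = 1" "\<bar>\<tau>\<bar> = 1" for \<sigma> \<tau>
  proof -
    have "(\<integral>\<^sup>+u. \<integral>\<^sup>+v. ennreal ((f u powr p) powr (1/p) * (g v powr q) powr (1/q)
      * (gauss_weight (x + \<sigma> * u + \<tau> * v) powr (1/c)) powr c) \<partial>lborel \<partial>lborel) < \<infinity>"
      using exps c that fin
      by (intro young_three_finite) (auto simp: nn_integral_gauss_weight_powr c_def)
    then show ?thesis
      using exps c nonneg by (simp add: powr_powr gauss_weight_nonneg)
  qed
  have "(\<integral>\<^sup>+u. \<integral>\<^sup>+v. ennreal (f u * g v * conv_kernel x u v) \<partial>lborel \<partial>lborel)
      = (\<Sum>\<sigma>\<in>{1, -1}. \<Sum>\<tau>\<in>{1, -1}.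
          \<integral>\<^sup>+u. \<integral>\<^sup>+v. ennreal (f u * g v * gauss_weight (x + \<sigma> * u + \<tau> * v)) \<partial>lborel \<partial>lborel)"
    using nonneg by (simp add: ennreal_mult_conv_kernel nn_integral_add)
  also have "\<dots> < \<infinity>"
    unfolding infinity_ennreal_def
    by (simp only: ennreal_sum_less_top finite.intros)
      (intro ballI term_finite[unfolded infinity_ennreal_def]; auto)
  finally show ?thesis .
qed

text \<open>The four-function inequality is applied to \<open>f powr p\<close>,
  \<open>g powr q\<close>, \<open>h powr s\<close> and \<open>gauss_weight powr r\<close> with the
  reciprocal exponents. All sign pairs obey the same bound, and the factor 4 counts them.\<close>

lemma nn_integral_conv_kernel_le:
  fixes f g h :: "real \<Rightarrow> real"
  assumes [measurable]: "f \<in> borel_measurable borel" "g \<in> borel_measurable borel"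
      "h \<in> borel_measurable borel"
    and nonneg: "\<And>u. 0 \<le> f u" "\<And>u. 0 \<le> g u" "\<And>u. 0 \<le> h u"
    and exps: "1 \<le> p" "1 \<le> q" "1 \<le> r" "1 \<le> s" "1/p + 1/q + 1/r + 1/s = 3"
    and bounds: "0 \<le> A" "0 \<le> B" "0 \<le> C"
    and le: "(\<integral>\<^sup>+u. f u powr p \<partial>lborel) \<le> ennreal A" "(\<integral>\<^sup>+u. g u powr q \<partial>lborel) \<le> ennreal B"
      "(\<integral>\<^sup>+u. h u powr s \<partial>lborel) \<le> ennreal C"
  shows "(\<integral>\<^sup>+x. \<integral>\<^sup>+u. \<integral>\<^sup>+v. ennreal (f u * g v * h x * conv_kernel x u v) \<partial>lborel \<partial>lborel \<partial>lborel)
    \<le> ennreal (4 * (A powr (1/p) * B powr (1/q) * C powr (1/s) * sqrt (2 * pi / r) powr (1/r)))"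
proof -
  let ?P = "A powr (1/p) * B powr (1/q) * C powr (1/s) * sqrt (2 * pi / r) powr (1/r)"
  let ?T = "\<lambda>\<sigma> \<tau>. \<integral>\<^sup>+x. \<integral>\<^sup>+u. \<integral>\<^sup>+v. ennreal (f u * g v * h x * gauss_weight (x + \<sigma> * u + \<tau> * v))
      \<partial>lborel \<partial>lborel \<partial>lborel"
  have T_le: "?T \<sigma> \<tau> \<le> ennreal ?P" if "\<bar>\<sigma>\<bar> = 1" "\<bar>\<tau>\<bar> = 1" for \<sigma> \<tau>
  proof -
    have "(\<integral>\<^sup>+x. \<integral>\<^sup>+u. \<integral>\<^sup>+v. ennreal ((f u powr p) powr (1/p) * (g v powr q) powr (1/q)
        * (h x powr s) powr (1/s) * (gauss_weight (x + \<sigma> * u + \<tau> * v) powr r) powr (1/r))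
      \<partial>lborel \<partial>lborel \<partial>lborel) \<le> ennreal ?P"
      using exps bounds le that by (intro young_four) (auto simp: nn_integral_gauss_weight_powr)
    then show ?thesis
      using exps nonneg by (simp add: powr_powr gauss_weight_nonneg)
  qed
  have "(\<integral>\<^sup>+x. \<integral>\<^sup>+u. \<integral>\<^sup>+v. ennreal (f u * g v * h x * conv_kernel x u v) \<partial>lborel \<partial>lborel \<partial>lborel)
      = (\<Sum>\<sigma>\<in>{1, -1}. \<Sum>\<tau>\<in>{1, -1}. ?T \<sigma> \<tau>)"
    using nonneg by (simp add: ennreal_mult_conv_kernel nn_integral_add)
  also have "\<dots> \<le> (\<Sum>\<sigma>\<in>{1, -1::real}. \<Sum>\<tau>\<in>{1, -1::real}. ennreal ?P)"
    by (intro sum_mono T_le; auto)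
  also have "\<dots> = ennreal (4 * ?P)"
    by (simp add: ennreal_mult')
  finally show ?thesis .
qed

section \<open>Almost-everywhere equality and measurability on the plane\<close>

text \<open>The exceptional set is enclosed in a Borel null set, and the cylinder over that is null
  in the product. Together with its counterpart for \<open>snd\<close> this permits replacing
  \<open>f\<close> and \<open>g\<close> inside the planar integrand.\<close>

lemma AE_lborel_fst:
  assumes "AE x in lborel. P x"
  shows "AE w in (lborel :: ('a::euclidean_space \<times> 'b::euclidean_space) measure). P (fst w)"
proof -
  obtain N where N [measurable]: "N \<in> sets lborel" and "{x. \<not> P x} \<subseteq> N" "emeasure lborel N = 0"
    using assms by (auto elim!: AE_E)
  then have "AE x in lborel. x \<notin> N"
    by (intro AE_not_in) (auto simp: null_sets_def)
  then have "AE w in lborel \<Otimes>\<^sub>M (lborel :: 'b measure). fst w \<notin> N"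
    by (intro lborel_pair.AE_pair_measure; measurable) auto
  then show ?thesis
    unfolding lborel_prod using \<open>{x. \<not> P x} \<subseteq> N\<close> by (auto elim: eventually_mono)
qed

lemma AE_lborel_snd:
  assumes "AE x in lborel. P x"
  shows "AE w in (lborel :: ('a::euclidean_space \<times> 'b::euclidean_space) measure). P (snd w)"
proof -
  obtain N where N [measurable]: "N \<in> sets lborel" and "{x. \<not> P x} \<subseteq> N" "emeasure lborel N = 0"
    using assms by (auto elim!: AE_E)
  then have "AE x in lborel. x \<notin> N"
    by (intro AE_not_in) (auto simp: null_sets_def)
  then have "AE w in (lborel :: 'a measure) \<Otimes>\<^sub>M lborel. snd w \<notin> N"
    by (intro lborel_pair.AE_pair_measure; measurable)
  then show ?thesis
    unfolding lborel_prod using \<open>{x. \<not> P x} \<subseteq> N\<close> by (auto elim: eventually_mono)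
qed

lemma conv_integrand_cong_AE:
  assumes "AE u in lborel. f u = f' u" "AE v in lborel. g v = g' v"
  shows "AE w in lborel. conv_integrand f g x w = conv_integrand f' g' x w"
  using AE_lborel_fst[OF assms(1)] AE_lborel_snd[OF assms(2)]
  by eventually_elim (simp add: conv_integrand_def split_beta)

text \<open>Joint measurability in \<open>x\<close> and \<open>w\<close> is what makes the integral
  over \<open>w\<close> a Borel function of \<open>x\<close>.\<close>

lemma conv_integrand_measurable:
  assumes [measurable]: "f \<in> borel_measurable borel" "g \<in> borel_measurable borel"
  shows "(\<lambda>(x, w). conv_integrand f g x w) \<in> borel_measurable (borel \<Otimes>\<^sub>M borel)"
  unfolding conv_integrand_def split_beta borel_prod[symmetric] by measurable

lemma nn_integral_norm_conv_integrand:
  assumes [measurable]: "f \<in> borel_measurable borel" "g \<in> borel_measurable borel"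
  shows "(\<integral>\<^sup>+w. ennreal (norm (conv_integrand f g x w)) \<partial>lborel)
    = (\<integral>\<^sup>+u. \<integral>\<^sup>+v. ennreal (norm (f u) * norm (g v) * conv_kernel x u v) \<partial>lborel \<partial>lborel)"
  unfolding lborel_prod[symmetric]
  by (subst lborel.nn_integral_fst[symmetric])
    (auto simp: conv_integrand_def split_beta norm_mult conv_kernel_nonneg)

section \<open>The pairing inequality\<close>

text \<open>The integrability claims ensure that neither the convolution nor the pairing takes the
  default value 0 of a divergent integral, so the bound concerns genuine integrals.\<close>

theorem theorem2p1:
  fixes p q r s :: real and f g h :: "real \<Rightarrow> complex"
  assumes "1 < p" and "1 < q" and "1 < r" and "1 < s"
    and "1/p + 1/q + 1/r + 1/s = 3"
    and "f \<in> Lp_space p" and "g \<in> Lp_space q" and "h \<in> Lp_space s"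
  shows "gauss_weight \<in> Lp_space r
    \<and> (\<forall>x. integrable lebesgue (conv_integrand f g x))
    \<and> integrable lebesgue (\<lambda>x. cosine_conv f g x * h x)
    \<and> cmod (LINT x|lebesgue. cosine_conv f g x * h x)
        \<le> 1 / (2 * pi) * (sqrt (2 * pi / r)) powr (1 / r)
            * Lp_norm p f * Lp_norm q g * Lp_norm s h"
proof -
  let ?A = "LINT x|lebesgue. norm (f x) powr p" and ?B = "LINT x|lebesgue. norm (g x) powr q"
    and ?C = "LINT x|lebesgue. norm (h x) powr s"
  obtain f' where f' [measurable]: "f' \<in> borel_measurable borel" and f_eq: "AE x in lborel. f x = f' x"
    and f_int: "(\<integral>\<^sup>+x. ennreal (norm (f' x) powr p) \<partial>lborel) = ennreal ?A"
    using Lp_space_borel_representative \<open>f \<in> Lp_space p\<close> by blast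
  obtain g' where g' [measurable]: "g' \<in> borel_measurable borel" and g_eq: "AE x in lborel. g x = g' x"
    and g_int: "(\<integral>\<^sup>+x. ennreal (norm (g' x) powr q) \<partial>lborel) = ennreal ?B"
    using Lp_space_borel_representative \<open>g \<in> Lp_space q\<close> by blast
  obtain h' where h' [measurable]: "h' \<in> borel_measurable borel" and h_eq: "AE x in lborel. h x = h' x"
    and h_int: "(\<integral>\<^sup>+x. ennreal (norm (h' x) powr s) \<partial>lborel) = ennreal ?C"
    using Lp_space_borel_representative \<open>h \<in> Lp_space s\<close> by blast
  have h_meas: "h \<in> borel_measurable lebesgue"
    using \<open>h \<in> Lp_space s\<close> by (simp add: Lp_space_def)
  have "1/p < 1" "1/q < 1" "1/r < 1" "1/s < 1"
    using assms(1-4) by simp_all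
  \<comment> \<open>The lower bound comes from \<open>1/r + 1/s < 2\<close> and the exponent
    identity; these are the conditions for convergence at every \<open>x\<close>.\<close>
  then have pq: "1 \<le> 1/p + 1/q" "1/p + 1/q < 2"
    using assms(5) by linarith+

  have gauss: "gauss_weight \<in> Lp_space r"
    using has_bochner_integral_gauss_weight_powr[of r] \<open>1 < r\<close>
    by (auto simp: Lp_space_def gauss_weight_nonneg has_bochner_integral_iff integrable_completion
        intro!: measurable_completion)

  \<comment> \<open>\<open>T\<close> is the convolution of the Borel representatives without its
    factor \<open>1 / (8 * pi)\<close>, and \<open>S\<close> is the integral of the modulus, which
    dominates it.\<close>
  define T where "T x = (LINT w|lborel. conv_integrand f' g' x w)" for x
  define S where "S x = (\<integral>\<^sup>+w. ennreal (norm (conv_integrand f' g' x w)) \<partial>lborel)" for x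
  have integrand_meas: "conv_integrand f' g' x \<in> borel_measurable lborel" for x
    using measurable_compose[OF measurable_Pair1' conv_integrand_measurable[OF f' g'], of x]
    by simp
  have S_eq: "S x = (\<integral>\<^sup>+u. \<integral>\<^sup>+v. ennreal (norm (f' u) * norm (g' v) * conv_kernel x u v) \<partial>lborel \<partial>lborel)" for x
    unfolding S_def by (rule nn_integral_norm_conv_integrand) simp_all
  have "S x < \<infinity>" for x
    unfolding S_eq using assms(1-2) pq f_int g_int
    by (intro nn_integral_conv_kernel_finite[of _ _ p q]) auto
  then have int': "integrable lborel (conv_integrand f' g' x)" for x
    using integrand_meas unfolding S_def by (intro integrableI_bounded)
  have integrand_eq: "AE w in lebesgue. conv_integrand f' g' x w = conv_integrand f g x w" for x
    using conv_integrand_cong_AE[OF f_eq g_eq, of x] by (intro AE_completion; elim eventually_mono) simp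
  have integrand_meas': "conv_integrand f g x \<in> borel_measurable lebesgue" for x
    using borel_measurable_AE[OF measurable_completion[OF integrand_meas] integrand_eq] .
  have int: "integrable lebesgue (conv_integrand f g x)" for x
    using integrable_cong_AE_imp[OF _ integrand_meas'] int' integrand_eq integrand_meas
    by (metis integrable_completion)
  \<comment> \<open>For each \<open>x\<close> the two integrands differ only on a null set of the
    plane, so this equality holds at every point, not just almost everywhere.\<close>
  have conv_eq: "cosine_conv f g x = complex_of_real (1 / (8 * pi)) * T x" for x
  proof -
    have "(LINT w|lebesgue. conv_integrand f g x w) = (LINT w|lebesgue. conv_integrand f' g' x w)"
      using integrand_eq[of x] integrand_meas'[of x] measurable_completion[OF integrand_meas[of x]]
      by (intro integral_cong_AE) (auto elim: eventually_mono)
    then show ?thesis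
      using integrand_meas by (simp add: cosine_conv_def T_def integral_completion)
  qed
  have T_meas: "T \<in> borel_measurable borel"
    unfolding T_def
    by (intro lborel.borel_measurable_lebesgue_integral)
      (use conv_integrand_measurable[OF f' g'] in \<open>simp cong: measurable_cong_sets\<close>)
  have T_le: "ennreal (norm (T x)) \<le> S x" for x
    unfolding T_def S_def using int' by (rule integral_norm_bound_ennreal)

  let ?P = "?A powr (1/p) * ?B powr (1/q) * ?C powr (1/s) * sqrt (2 * pi / r) powr (1/r)"
  \<comment> \<open>One bound on the integral of the modulus yields both the integrability of the
    pairing and the final estimate.\<close>
  have "(\<integral>\<^sup>+x. ennreal (norm (cosine_conv f g x * h x)) \<partial>lebesgue)
      = (\<integral>\<^sup>+x. ennreal (norm (cosine_conv f g x * h' x)) \<partial>lborel)"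
    unfolding nn_integral_completion using h_eq by (intro nn_integral_cong_AE) (auto elim: eventually_mono)
  also have "\<dots> \<le> (\<integral>\<^sup>+x. ennreal (1 / (8 * pi)) * (\<integral>\<^sup>+u. \<integral>\<^sup>+v.
      ennreal (norm (f' u) * norm (g' v) * norm (h' x) * conv_kernel x u v) \<partial>lborel \<partial>lborel) \<partial>lborel)"
  proof (intro nn_integral_mono)
    fix x
    have "ennreal (norm (cosine_conv f g x * h' x))
        = ennreal (1 / (8 * pi)) * (ennreal (norm (T x)) * ennreal (norm (h' x)))"
      unfolding conv_eq norm_mult norm_of_real by (simp flip: ennreal_mult)
    also have "\<dots> \<le> ennreal (1 / (8 * pi)) * (S x * ennreal (norm (h' x)))"
      by (intro mult_left_mono mult_right_mono T_le) auto
    also have "S x * ennreal (norm (h' x)) = (\<integral>\<^sup>+u. \<integral>\<^sup>+v.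
      ennreal (norm (f' u) * norm (g' v) * norm (h' x) * conv_kernel x u v) \<partial>lborel \<partial>lborel)"
    proof -
      have "ennreal (norm (f' u) * norm (g' v) * norm (h' x) * conv_kernel x u v)
          = ennreal (norm (h' x)) * ennreal (norm (f' u) * norm (g' v) * conv_kernel x u v)" for u v
        by (simp add: mult_ac flip: ennreal_mult')
      then show ?thesis
        unfolding S_eq by (simp add: nn_integral_cmult mult.commute)
    qed
    finally show "ennreal (norm (cosine_conv f g x * h' x)) \<le> ennreal (1 / (8 * pi)) * \<dots>" .
  qed
  also have "\<dots> = ennreal (1 / (8 * pi)) * (\<integral>\<^sup>+x. \<integral>\<^sup>+u. \<integral>\<^sup>+v.
      ennreal (norm (f' u) * norm (g' v) * norm (h' x) * conv_kernel x u v) \<partial>lborel \<partial>lborel \<partial>lborel)"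
    by (simp add: nn_integral_cmult)
  also have "\<dots> \<le> ennreal (1 / (8 * pi)) * ennreal (4 * ?P)"
    using assms(1-5) f_int g_int h_int
    by (intro mult_left_mono nn_integral_conv_kernel_le) auto
  \<comment> \<open>The four sign pairs against the prefactor:
    \<open>4 / (8 * pi) = 1 / (2 * pi)\<close>.\<close>
  also have "\<dots> = ennreal (1 / (2 * pi) * ?P)"
    by (simp flip: ennreal_mult)
  finally have le: "(\<integral>\<^sup>+x. ennreal (norm (cosine_conv f g x * h x)) \<partial>lebesgue) \<le> ennreal (1 / (2 * pi) * ?P)" .

  have "T \<in> borel_measurable lebesgue"
    using T_meas by (intro measurable_completion) simp
  then have "(\<lambda>x. cosine_conv f g x * h x) \<in> borel_measurable lebesgue"
    unfolding conv_eq using h_meas by (intro borel_measurable_times borel_measurable_const)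
  moreover have "(\<integral>\<^sup>+x. ennreal (norm (cosine_conv f g x * h x)) \<partial>lebesgue) < \<infinity>"
    using le by (rule le_less_trans) simp
  ultimately have int_pairing: "integrable lebesgue (\<lambda>x. cosine_conv f g x * h x)"
    by (rule integrableI_bounded)
  have "ennreal (cmod (LINT x|lebesgue. cosine_conv f g x * h x)) \<le> ennreal (1 / (2 * pi) * ?P)"
    using integral_norm_bound_ennreal[OF int_pairing] le by (rule order_trans)
  then have "cmod (LINT x|lebesgue. cosine_conv f g x * h x) \<le> 1 / (2 * pi) * ?P"
    by (subst (asm) ennreal_le_iff) auto
  then show ?thesis
    using gauss int int_pairing by (simp add: Lp_norm_def mult_ac)
qed

end
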